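(* Let $\alpha,\beta,\delta,a_1\in\mathbb C$ and put $\lambda_N=N-N(N-1)\alpha$ for $N=0,1,2,\dots$; assume that the numbers $\lambda_N$, $N\ge0$, are pairwise distinct. Let $\{y_N(x)\}_{N=0}^\infty$ be a system of polynomials such that, for each $N$, $y_N$ is an Ulam polynomial of degree $N$ and a solution of the differential equation $$(\alpha x^2+\beta x+\delta)\,y_N''(x)-(x+a_1)\,y_N'(x)+\lambda_N\,y_N(x)=0.$$ Then $a_1=\beta=\delta=0$ and $y_N(x)=x^N$ for all $N=0,1,2,\dots$. In other words, the only Ulam polynomial eigenfunctions of such hypergeometric type differential operators are the polynomials $\{x^N\}_{N=0}^\infty$, which are eigenfunctions of the differential operator $\alpha x^2\frac{d^2}{dx^2}-x\frac{d}{dx}$ with the corresponding eigenvalues $\{N(N-1)\alpha-N\}_{N=0}^\infty$.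
   Context: An Ulam polynomial of degree $N$ is a monic polynomial $x^N+\sum_{m=1}^N\gamma_mx^{N-m}$ with complex coefficients such that $x^N+\sum_{m=1}^N\gamma_mx^{N-m}=\prod_{n=1}^N(x-\gamma_n)$, i.e. its (non-leading) coefficients coincide with its zeros; for $N=0$ this is the constant polynomial $1$. The hypergeometric type differential operators in question are $p(x)\frac{d^2}{dx^2}+q(x)\frac{d}{dx}$ with $p(x)=\alpha x^2+\beta x+\delta$ and $q(x)=-(x+a_1)$. *)

theory Defs
  imports Complex_Main "HOL-Computational_Algebra.Polynomial"
begin

definition ulam_poly :: "nat \<Rightarrow> complex poly \<Rightarrow> bool" where
  "ulam_poly N f \<longleftrightarrow> (\<exists>\<gamma> :: nat \<Rightarrow> complex.
     f = monom 1 N + (\<Sum>m=1..N. monom (\<gamma> m) (N - m)) \<and>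
     f = (\<Prod>n=1..N. [:- \<gamma> n, 1:]))"

definition lam :: "complex \<Rightarrow> nat \<Rightarrow> complex" where
  "lam \<alpha> N = of_nat N - of_nat N * (of_nat N - 1) * \<alpha>"

definition hypergeom_op :: "complex poly \<Rightarrow> complex poly \<Rightarrow> complex poly \<Rightarrow> complex poly" where
  "hypergeom_op p q f = p * pderiv (pderiv f) + q * pderiv f"

definition eigenfunction :: "(complex poly \<Rightarrow> complex poly) \<Rightarrow> complex \<Rightarrow> complex poly \<Rightarrow> bool" where
  "eigenfunction L \<mu> f \<longleftrightarrow> f \<noteq> 0 \<and> L f = smult \<mu> f"

end

theory Submission
  imports Defs
begin

text \<open>
  Comparing coefficients, an eigenpolynomial of degree \<open>N\<close> is determined by a three-term recurrence
  whose leading factors \<open>\<lambda>\<^sub>N - \<lambda>\<^sub>k\<close> do not vanish. The linear Ulam polynomial is \<open>x\<close>, which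
  forces \<open>a\<^sub>1 = 0\<close>. The quadratic ones are \<open>x\<^sup>2\<close>, which forces \<open>\<beta> = \<delta> = 0\<close> and hence
  \<open>y\<^sub>N = x\<^sup>N\<close>, and \<open>x\<^sup>2 + x - 2\<close>, for which \<open>\<beta>\<close> and \<open>\<delta>\<close> become functions of \<open>\<alpha>\<close>. In the latter
  case, the cubic eigenpolynomial satisfies the Ulam conditions for no \<open>\<alpha>\<close>.
\<close>

text \<open>\<open>L\<close> stays free because two values matter: \<open>lam \<alpha> N\<close>
  yields the recurrence for an eigenpolynomial of degree \<open>N\<close>, and \<open>0\<close>
  yields the action of the operator itself on a monomial.\<close>

lemma coeff_hypergeom_equation:
  fixes f :: "complex poly"
  shows "coeff ([:\<delta>, \<beta>, \<alpha>:] * pderiv (pderiv f) - [:a1, 1:] * pderiv f + smult L f) k =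
    (L - lam \<alpha> k) * coeff f k + of_nat (k + 1) * (of_nat k * \<beta> - a1) * coeff f (k + 1)
      + of_nat (k + 2) * of_nat (k + 1) * \<delta> * coeff f (k + 2)"
proof (cases k)
  case 0
  then show ?thesis by (simp add: coeff_pderiv lam_def algebra_simps numeral_2_eq_2)
next
  case (Suc j)
  then show ?thesis
    by (cases j) (simp_all add: coeff_pderiv lam_def algebra_simps)
qed

lemma ulam_poly_lead_coeff:
  assumes "ulam_poly N f"
  shows "coeff f N = 1"
proof -
  obtain \<gamma> where f: "f = monom 1 N + (\<Sum>m=1..N. monom (\<gamma> m) (N - m))"
    using assms unfolding ulam_poly_def by blast
  have "(\<Sum>m=1..N. coeff (monom (\<gamma> m) (N - m)) N) = 0"
    by (rule sum.neutral) auto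
  then show ?thesis by (simp add: f coeff_sum)
qed

lemma ulam_poly_monom: "ulam_poly N (monom 1 N)"
  unfolding ulam_poly_def
  by (rule exI[of _ "\<lambda>_. 0"]) (simp add: monom_altdef)

lemma ulam_poly_1:
  assumes "ulam_poly 1 f"
  shows "f = [:0, 1:]"
  using assms by (auto simp: ulam_poly_def monom_altdef)

text \<open>By Vieta, the two conditions on the zeros reduce to
  \<open>\<gamma> 1 * (\<gamma> 1 - 1) = 0\<close> with
  \<open>\<gamma> 2 = - 2 * \<gamma> 1\<close>.\<close>

lemma ulam_poly_2:
  assumes "ulam_poly 2 f"
  shows "f = [:0, 0, 1:] \<or> f = [:-2, 1, 1:]"
proof -
  obtain \<gamma> where f: "f = monom 1 2 + (\<Sum>m=1..2. monom (\<gamma> m) (2 - m))"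
    and g: "f = (\<Prod>n=1..2. [:- \<gamma> n, 1:])"
    using assms unfolding ulam_poly_def by blast
  have f': "f = [:\<gamma> 2, \<gamma> 1, 1:]"
    using f by (simp add: eval_nat_numeral monom_altdef)
  have g': "f = [:\<gamma> 1 * \<gamma> 2, - \<gamma> 1 - \<gamma> 2, 1:]"
    using g by (simp add: eval_nat_numeral)
  have e: "\<gamma> 2 = \<gamma> 1 * \<gamma> 2" "\<gamma> 1 = - \<gamma> 1 - \<gamma> 2"
    using f' g' by simp_all
  have "\<gamma> 2 = - 2 * \<gamma> 1"
    using e(2) by algebra
  moreover have "\<gamma> 1 = 0 \<or> \<gamma> 1 = 1"
    using e by algebra
  ultimately show ?thesis using f' by auto
qed

lemma ulam_poly_3:
  assumes "ulam_poly 3 f"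
  obtains a b c where "f = [:c, b, a, 1:]"
    "a = - (a + b + c)" "b = a * b + a * c + b * c" "c = - (a * b * c)"
proof -
  obtain \<gamma> where f: "f = monom 1 3 + (\<Sum>m=1..3. monom (\<gamma> m) (3 - m))"
    and g: "f = (\<Prod>n=1..3. [:- \<gamma> n, 1:])"
    using assms unfolding ulam_poly_def by blast
  have f': "f = [:\<gamma> 3, \<gamma> 2, \<gamma> 1, 1:]"
    using f by (simp add: eval_nat_numeral monom_altdef)
  have "(\<Prod>n=1..3. [:- \<gamma> n, 1:]) = [:- \<gamma> 1, 1:] * [:- \<gamma> 2, 1:] * [:- \<gamma> 3, 1:]"
    by (simp add: eval_nat_numeral)
  then have g': "f = [:- (\<gamma> 1 * \<gamma> 2 * \<gamma> 3), \<gamma> 1 * \<gamma> 2 + \<gamma> 1 * \<gamma> 3 + \<gamma> 2 * \<gamma> 3,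
      - (\<gamma> 1 + \<gamma> 2 + \<gamma> 3), 1:]"
    using g by (simp add: algebra_simps)
  show ?thesis
    using that[OF f'] f' unfolding g' by simp
qed

text \<open>The hypotheses on \<open>c, b, a\<close> are the Ulam conditions for \<open>x\<^sup>3 + a x\<^sup>2 + b x + c\<close> and the
  recurrence for \<open>N = 3\<close> with \<open>2\<beta> = -(1 - 2\<alpha>)\<close> and \<open>\<delta> = 2(1 - \<alpha>)\<close>.\<close>

lemma no_ulam_cubic:
  fixes \<alpha> a b c :: complex
  assumes "1 - \<alpha> \<noteq> 0" and "1 - 2 * \<alpha> \<noteq> 0"
    and u: "a = - (a + b + c)" "b = a * b + a * c + b * c" "c = - (a * b * c)"
    and r2: "(1 - 4 * \<alpha>) * a = 3 * (1 - 2 * \<alpha>)"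
    and r0: "3 * (1 - 2 * \<alpha>) * c = - 4 * (1 - \<alpha>) * a"
  shows False
proof -
  have "a \<noteq> 0" using r2 assms(2) by auto
  then have "c \<noteq> 0" using r0 assms(1) by auto
  then have ab: "a * b = - 1" using u(3) by algebra
  \<comment> \<open>Solving \<open>r2\<close> for \<alpha> gives
    \<open>\<alpha> * s = 3 - a\<close>. Multiplying \<open>r0\<close> by \<open>s\<close> therefore
    eliminates \<alpha>, with no need for \<open>s\<close> to be nonzero.\<close>
  define s where "s = 6 - 4 * a"
  have s: "(1 - 2 * \<alpha>) * s = - 2 * a" "(1 - \<alpha>) * s = 3 - 3 * a"
    unfolding s_def using r2 by algebra+
  have ac: "a * c = 1 - 2 * a ^ 2" using u(1) ab by algebra
  have "3 * ((1 - 2 * \<alpha>) * s) * c = - 4 * ((1 - \<alpha>) * s) * a"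
    using r0 by algebra
  then have "c = 2 * (1 - a)" unfolding s using \<open>a \<noteq> 0\<close> by algebra
  with ac have a: "2 * a = 1" by algebra
  \<comment> \<open>This is \<open>u(2)\<close> times \<open>a ^ 2\<close>, with
    \<open>a * b\<close> and \<open>a * c\<close> substituted; at \<open>a = 1/2\<close> the left
    side equals \<open>1/8\<close>.\<close>
  have "2 * a ^ 4 - 2 * a ^ 2 - a + 1 = 0" using u(2) ab ac by algebra
  with a show False by algebra
qed

theorem theorem4p1:
  fixes \<alpha> \<beta> \<delta> a1 :: complex
  assumes "inj (lam \<alpha>)"
  shows "(\<forall>y :: nat \<Rightarrow> complex poly.
           (\<forall>N. ulam_poly N (y N) \<and>
                [:\<delta>, \<beta>, \<alpha>:] * pderiv (pderiv (y N)) - [:a1, 1:] * pderiv (y N)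
                  + smult (lam \<alpha> N) (y N) = 0)
           \<longrightarrow> a1 = 0 \<and> \<beta> = 0 \<and> \<delta> = 0 \<and> (\<forall>N. y N = monom 1 N))
       \<and> (\<forall>N. ulam_poly N (monom 1 N) \<and>
             eigenfunction (hypergeom_op [:0, 0, \<alpha>:] [:0, -1:])
               (of_nat N * (of_nat N - 1) * \<alpha> - of_nat N) (monom 1 N))"
proof (intro conjI allI impI ulam_poly_monom)
  \<comment> \<open>The two differences are \<open>2 * (1 - \<alpha>)\<close> and
    \<open>1 - 2 * \<alpha>\<close>.\<close>
  have "lam \<alpha> 2 \<noteq> lam \<alpha> 0" "lam \<alpha> 2 \<noteq> lam \<alpha> 1"
    using assms by (simp_all add: inj_eq)
  then have n0: "1 - \<alpha> \<noteq> 0" and n1: "1 - 2 * \<alpha> \<noteq> 0"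
    by (auto simp: lam_def algebra_simps)
  fix y :: "nat \<Rightarrow> complex poly"
  assume y: "\<forall>N. ulam_poly N (y N) \<and>
    [:\<delta>, \<beta>, \<alpha>:] * pderiv (pderiv (y N)) - [:a1, 1:] * pderiv (y N) + smult (lam \<alpha> N) (y N) = 0"
  have rec: "(lam \<alpha> N - lam \<alpha> k) * coeff (y N) k
      + of_nat (k + 1) * (of_nat k * \<beta> - a1) * coeff (y N) (k + 1)
      + of_nat (k + 2) * of_nat (k + 1) * \<delta> * coeff (y N) (k + 2) = 0" for N k
    using y coeff_hypergeom_equation[of \<delta> \<beta> \<alpha> "y N" a1 "lam \<alpha> N" k] by (metis coeff_0)
  have "y 1 = [:0, 1:]" using y ulam_poly_1 by blast
  then show a1: "a1 = 0" using rec[of 1 0] by simp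
  have y2: "y 2 = [:0, 0, 1:]"
  proof (rule ccontr)
    assume "y 2 \<noteq> [:0, 0, 1:]"
    then have y2: "y 2 = [:-2, 1, 1:]" using y ulam_poly_2 by blast
    have \<beta>: "2 * \<beta> = - (1 - 2 * \<alpha>)"
      using rec[of 2 1] unfolding y2 by (simp add: a1 lam_def eval_nat_numeral) algebra
    have \<delta>: "\<delta> = 2 * (1 - \<alpha>)"
      using rec[of 2 0] unfolding y2 by (simp add: a1 lam_def eval_nat_numeral) algebra
    obtain a b c where y3: "y 3 = [:c, b, a, 1:]"
      and u: "a = - (a + b + c)" "b = a * b + a * c + b * c" "c = - (a * b * c)"
      using y ulam_poly_3 by metis
    have "(1 - 4 * \<alpha>) * a + 6 * \<beta> = 0"
      using rec[of 3 2] unfolding y3 by (simp add: a1 lam_def eval_nat_numeral)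
    then have r2: "(1 - 4 * \<alpha>) * a = 3 * (1 - 2 * \<alpha>)" using \<beta> by algebra
    \<comment> \<open>At \<open>k = 0\<close> the factor \<open>of_nat k * \<beta> - a1\<close>
      vanishes, so \<open>b\<close> drops out.\<close>
    have "3 * (1 - 2 * \<alpha>) * c + 2 * \<delta> * a = 0"
      using rec[of 3 0] unfolding y3 by (simp add: a1 lam_def eval_nat_numeral)
    then have r0: "3 * (1 - 2 * \<alpha>) * c = - 4 * (1 - \<alpha>) * a" using \<delta> by algebra
    show False using no_ulam_cubic[OF n0 n1 u r2 r0] .
  qed
  show \<beta>: "\<beta> = 0" using rec[of 2 1] unfolding y2 by (simp add: a1 eval_nat_numeral)
  show \<delta>: "\<delta> = 0" using rec[of 2 0] unfolding y2 by (simp add: a1 eval_nat_numeral)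
  fix N
  show "y N = monom 1 N"
  proof (rule poly_eqI)
    fix k
    \<comment> \<open>The recurrence is now
      \<open>(lam \<alpha> N - lam \<alpha> k) * coeff (y N) k = 0\<close>, which kills every
      coefficient except the leading one.\<close>
    have "lam \<alpha> N = lam \<alpha> k \<longleftrightarrow> N = k" using assms by (simp add: inj_eq)
    then show "coeff (y N) k = coeff (monom 1 N) k"
      using rec[of N k] y ulam_poly_lead_coeff[of N "y N"] by (auto simp: a1 \<beta> \<delta>)
  qed
next
  fix N
  have "hypergeom_op [:0, 0, \<alpha>:] [:0, -1:] (monom 1 N) =
    smult (of_nat N * (of_nat N - 1) * \<alpha> - of_nat N) (monom 1 N)"
  proof (rule poly_eqI)
    fix k
    have "[:0, -1:] * pderiv (monom 1 N) = - ([:0, 1:] * pderiv (monom (1::complex) N))"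
      by simp
    then show "coeff (hypergeom_op [:0, 0, \<alpha>:] [:0, -1:] (monom 1 N)) k =
      coeff (smult (of_nat N * (of_nat N - 1) * \<alpha> - of_nat N) (monom 1 N)) k"
      using coeff_hypergeom_equation[of 0 0 \<alpha> "monom 1 N" 0 0 k]
      by (auto simp: hypergeom_op_def lam_def)
  qed
  then show "eigenfunction (hypergeom_op [:0, 0, \<alpha>:] [:0, -1:])
      (of_nat N * (of_nat N - 1) * \<alpha> - of_nat N) (monom 1 N)"
    by (simp add: eigenfunction_def)
qed

end
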